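(* Let $\mathcal{J}(m,n)$ be the number of 02-partitions of $n$ of length $m$. Then, as formal power series in $z$ and $q$, $$\sum_{m,n\geq 0}\mathcal{J}(m,n)\, z^m q^n = \frac{(z^3q^6;q^3)_\infty}{(zq^2;q)_\infty\,(z^2q^2;q)_\infty}.$$
   Context: A 02-partition of a non-negative integer $n$ of length $m$ is a sequence $(n_1,\dots,n_m)$ of non-negative integers with $\sum_i n_i = n$, last entry $n_m \geq 2$ (when $m\ge1$), and $n_j \geq n_{j+1}-2$, $n_j \geq n_{j+2}$ whenever the indices are in range. The empty sequence is the unique 02-partition of length $0$ (of $n=0$). Notation: $(a;q)_\infty = \prod_{i\ge0}(1-aq^i)$. *)

theory Defs
  imports "HOL-Analysis.Analysis" "HOL-Computational_Algebra.Formal_Power_Series"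
begin

(* The entry n_i is xs ! (i - 1). The condition n_j >= n_(j+1) - 2 is written without
   subtraction because subtraction on nat truncates. *)
definition is_02_partition :: "nat \<Rightarrow> nat list \<Rightarrow> bool" where
  "is_02_partition n xs \<longleftrightarrow>
     sum_list xs = n \<and>
     (xs \<noteq> [] \<longrightarrow> last xs \<ge> 2) \<and>
     (\<forall>j. j + 1 < length xs \<longrightarrow> xs ! j + 2 \<ge> xs ! (j + 1)) \<and>
     (\<forall>j. j + 2 < length xs \<longrightarrow> xs ! j \<ge> xs ! (j + 2))"

definition J02 :: "nat \<Rightarrow> nat \<Rightarrow> nat" where
  "J02 m n = card {xs. is_02_partition n xs \<and> length xs = m}"

definition qpoch_inf :: "'a::{t2_space, comm_ring_1} \<Rightarrow> 'a \<Rightarrow> 'a" where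
  "qpoch_inf a q = (\<Prod>i. 1 - a * q ^ i)"

(* Formal power series in z and q are Q[[z]][[q]]: the outer indeterminate is q, so the coefficient
   of z^m q^n in f is fps_nth (fps_nth f n) m. The library topology on this type is the q-adic one,
   in which infinite products such as (zq^2; q) converge. *)
type_synonym zq_fps = "rat fps fps"

abbreviation fps_q :: zq_fps where "fps_q \<equiv> fps_X"

abbreviation fps_z :: zq_fps where "fps_z \<equiv> fps_const fps_X"

definition zq_gf :: "(nat \<Rightarrow> nat \<Rightarrow> nat) \<Rightarrow> zq_fps" where
  "zq_gf c = Abs_fps (\<lambda>n. Abs_fps (\<lambda>m. of_nat (c m n)))"

end

(* Cut a 02-partition greedily into blocks: an entry followed by a larger one forms a pair
   (k - 1, k) or (k - 1, k + 1) with it, every other entry k is a block of its own. The averages of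
   the blocks decrease weakly, and the only adjacency of equal averages that is forbidden is the one
   of [k] and [k - 1, k + 1]. With A = z q^k and B = z^2 q^(2k), the blocks of average k >= 2
   therefore contribute 1/(1 - A) + 1/(1 - B) - 1 = (1 - AB) / ((1 - A) (1 - B)), where
   AB = z^3 q^(3k). The pairs of sum s contribute 1 / (1 - z^2 q^s) if s >= 3 is odd, and also for
   s = 2, since [1] is not a block. *)

theory Submission
  imports Defs
begin

section \<open>Infinite products of formal power series\<close>

text \<open>Coefficient \<open>n\<close> of a product depends only on the coefficients up to
  \<open>n\<close> of its factors, so finitely many eventual equalities suffice.\<close>

lemma tendsto_mult_fps:
  fixes a b :: "'a::ring_1 fps"
  assumes "(f \<longlongrightarrow> a) F" "(g \<longlongrightarrow> b) F"
  shows "((\<lambda>x. f x * g x) \<longlongrightarrow> a * b) F"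
proof (rule tendsto_fpsI)
  fix n
  have "\<forall>\<^sub>F x in F. \<forall>k\<in>{..n}. fps_nth (f x) k = fps_nth a k"
    by (subst eventually_ball_finite_distrib) (use assms(1) in \<open>auto simp: tendsto_fps_iff\<close>)
  moreover have "\<forall>\<^sub>F x in F. \<forall>k\<in>{..n}. fps_nth (g x) k = fps_nth b k"
    by (subst eventually_ball_finite_distrib) (use assms(2) in \<open>auto simp: tendsto_fps_iff\<close>)
  ultimately show "\<forall>\<^sub>F x in F. fps_nth (f x * g x) n = fps_nth (a * b) n"
    by eventually_elim (auto simp: fps_mult_nth)
qed

text \<open>The term \<open>a * q ^ i\<close> has nothing below degree \<open>i + 1\<close>, so
  coefficient \<open>k\<close> is final after \<open>k\<close> factors.\<close>

lemma
  fixes a q :: "'a::idom fps"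
  assumes a: "fps_nth a 0 = 0" and q: "fps_nth q 0 = 0"
  shows qpoch_inf_LIMSEQ: "(\<lambda>n. \<Prod>i<n. 1 - a * q ^ i) \<longlonglongrightarrow> qpoch_inf a q"
    and qpoch_inf_nth_0: "fps_nth (qpoch_inf a q) 0 = 1"
proof -
  define P where "P n = (\<Prod>i<n. 1 - a * q ^ i)" for n
  define L where "L = Abs_fps (\<lambda>k. fps_nth (P k) k)"
  have stable: "fps_nth (P (k + d)) k = fps_nth (P k) k" for k d
  proof (induction d)
    case (Suc d)
    have "fps_nth (P (k + d) * (a * q ^ (k + d))) k = 0"
    proof -
      have "fps_nth (q ^ (k + d) * (a * P (k + d))) k = 0"
      \<comment> \<open>For \<open>d = 0\<close> the power \<open>q ^ k\<close> kills only degrees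
        below \<open>k\<close>; degree \<open>k\<close> vanishes because \<open>a\<close> has
        constant term 0.\<close>
      proof (cases "d = 0")
        case True
        have "fps_nth (q ^ k) i * fps_nth (a * P k) (k - i) = 0" if "i \<le> k" for i
        proof (cases "i = k")
          case False
          then have "fps_nth (q ^ k) i = 0"
            using startsby_zero_power_prefix[OF q] that by (simp add: le_neq_implies_less)
          then show ?thesis by simp
        qed (simp add: a)
        then show ?thesis
          using True by (auto simp: fps_mult_nth[of "q ^ k"] intro!: sum.neutral)
      next
        case False
        then show ?thesis
          using startsby_zero_power_prefix[OF q]
          by (auto simp: fps_mult_nth[of "q ^ (k + d)"] intro!: sum.neutral)
      qed
      then show ?thesis by (simp add: ac_simps)
    qed
    moreover have "P (k + Suc d) = P (k + d) - P (k + d) * (a * q ^ (k + d))"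
      by (simp add: P_def algebra_simps)
    ultimately show ?case
      using Suc by simp
  qed simp
  have lim: "P \<longlonglongrightarrow> L"
  proof (rule tendsto_fpsI)
    show "\<forall>\<^sub>F n in sequentially. fps_nth (P n) k = fps_nth L k" for k
      using eventually_ge_at_top[of k]
      by eventually_elim (use stable[of k] in \<open>auto simp: L_def dest!: le_Suc_ex\<close>)
  qed
  have L0: "fps_nth L 0 = 1"
    by (simp add: L_def P_def)
  \<comment> \<open>\<open>raw_has_prod\<close> demands a nonzero limit.\<close>
  then have "L \<noteq> 0"
    by auto
  moreover have "(\<lambda>n. \<Prod>i\<le>n. 1 - a * q ^ i) \<longlonglongrightarrow> L"
    using LIMSEQ_Suc[OF lim] by (simp add: P_def lessThan_Suc_atMost)
  ultimately have "(\<lambda>i. 1 - a * q ^ i) has_prod L"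
    by (simp add: has_prod_def raw_has_prod_def)
  then have "qpoch_inf a q = L"
    unfolding qpoch_inf_def by (rule has_prod_unique[symmetric])
  then show "(\<lambda>n. \<Prod>i<n. 1 - a * q ^ i) \<longlonglongrightarrow> qpoch_inf a q" "fps_nth (qpoch_inf a q) 0 = 1"
    using lim L0 by (simp_all add: P_def[abs_def])
qed

text \<open>The coefficient ring \<open>rat fps\<close> is not a field; constant term 1 makes
  \<open>g\<close> a unit, so that dividing is multiplying by its inverse.\<close>

lemma zq_fps_divide_eqI:
  fixes f g h :: zq_fps
  assumes "f * g = h" "fps_nth g 0 = 1"
  shows "f = h / g"
proof -
  have "g * inverse g = 1"
    using assms(2) fps_right_inverse[of g 1] by (simp add: fps_inverse_def[of g])
  moreover have "h / g = h * inverse g"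
    using assms(2) by (intro fps_divide_unit) simp
  ultimately show ?thesis
    using assms(1) by (metis mult.assoc mult.right_neutral)
qed

section \<open>Generating functions of sets of lists\<close>

definition list_gf :: "nat list set \<Rightarrow> zq_fps" where
  "list_gf S = zq_gf (\<lambda>m n. card {xs \<in> S. sum_list xs = n \<and> length xs = m})"

lemma list_gf_nth:
  "fps_nth (fps_nth (list_gf S) n) m = of_nat (card {xs \<in> S. sum_list xs = n \<and> length xs = m})"
  by (simp add: list_gf_def zq_gf_def)

lemma finite_lists_sum_length: "finite {xs \<in> S. sum_list xs = (n::nat) \<and> length xs = m}"
proof (rule finite_subset)
  show "{xs \<in> S. sum_list xs = n \<and> length xs = m} \<subseteq> {xs. set xs \<subseteq> {..n} \<and> length xs = m}"
    using member_le_sum_list by auto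
qed (simp add: finite_lists_length_eq)

lemma list_gf_Un_Int: "list_gf (A \<union> B) + list_gf (A \<inter> B) = list_gf A + list_gf B"
proof (intro fps_ext)
  fix n m
  define C where "C S = {xs \<in> S. sum_list xs = n \<and> length xs = m}" for S :: "nat list set"
  have "C (A \<union> B) = C A \<union> C B" "C (A \<inter> B) = C A \<inter> C B"
    by (auto simp: C_def)
  then have "card (C (A \<union> B)) + card (C (A \<inter> B)) = card (C A) + card (C B)"
    using card_Un_Int[of "C A" "C B"] by (simp add: C_def finite_lists_sum_length)
  then show "fps_nth (fps_nth (list_gf (A \<union> B) + list_gf (A \<inter> B)) n) m =
      fps_nth (fps_nth (list_gf A + list_gf B) n) m"
    by (simp add: list_gf_nth C_def flip: of_nat_add)
qed

lemma list_gf_empty: "list_gf {} = 0"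
  by (intro fps_ext) (simp add: list_gf_nth)

lemma list_gf_Nil: "list_gf {[]} = 1"
proof (intro fps_ext)
  fix n m :: nat
  have "{xs \<in> {[]}. sum_list xs = n \<and> length xs = m} = (if n = 0 \<and> m = 0 then {[]} else {})"
    by auto
  then show "fps_nth (fps_nth (list_gf {[]}) n) m = fps_nth (fps_nth 1 n) m"
    by (simp add: list_gf_nth)
qed

lemma list_gf_append:
  "list_gf ((@) b ` S) = fps_z ^ length b * fps_q ^ sum_list b * list_gf S"
proof (intro fps_ext)
  fix n m
  have "card {xs \<in> (@) b ` S. sum_list xs = n \<and> length xs = m} =
      (if sum_list b \<le> n \<and> length b \<le> m
       then card {xs \<in> S. sum_list xs = n - sum_list b \<and> length xs = m - length b} else 0)"
  proof (cases "sum_list b \<le> n \<and> length b \<le> m")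
    case True
    then have "{xs \<in> (@) b ` S. sum_list xs = n \<and> length xs = m} =
        (@) b ` {xs \<in> S. sum_list xs = n - sum_list b \<and> length xs = m - length b}"
      by auto
    with True show ?thesis
      by (simp add: card_image inj_on_def)
  next
    case False
    then have "{xs \<in> (@) b ` S. sum_list xs = n \<and> length xs = m} = {}"
      by auto
    with False show ?thesis
      by (simp only: card.empty if_False)
  qed
  then show "fps_nth (fps_nth (list_gf ((@) b ` S)) n) m =
      fps_nth (fps_nth (fps_z ^ length b * fps_q ^ sum_list b * list_gf S) n) m"
    by (simp add: list_gf_nth mult.assoc fps_X_power_mult_nth)
qed

section \<open>Blocks of 02-partitions\<close>

text \<open>Supplying the list's own sum makes the sum condition trivial and leaves the shape
  conditions.\<close>

definition valid02 :: "nat list \<Rightarrow> bool" where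
  "valid02 xs \<longleftrightarrow> is_02_partition (sum_list xs) xs"

lemma valid02_simps [simp]:
  "valid02 []"
  "valid02 [x] \<longleftrightarrow> 2 \<le> x"
  "valid02 [x, y] \<longleftrightarrow> y \<le> x + 2 \<and> 2 \<le> y"
  "valid02 (x # y # z # r) \<longleftrightarrow> y \<le> x + 2 \<and> z \<le> x \<and> valid02 (y # z # r)"
proof -
  have all_nat: "(\<forall>j. P j) \<longleftrightarrow> P 0 \<and> (\<forall>j. P (Suc j))" for P :: "nat \<Rightarrow> bool"
    by (metis not0_implies_Suc)
  show "valid02 []" "valid02 [x] \<longleftrightarrow> 2 \<le> x" "valid02 [x, y] \<longleftrightarrow> y \<le> x + 2 \<and> 2 \<le> y"
    by (auto simp: valid02_def is_02_partition_def)
  show "valid02 (x # y # z # r) \<longleftrightarrow> y \<le> x + 2 \<and> z \<le> x \<and> valid02 (y # z # r)"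
    unfolding valid02_def is_02_partition_def
    by (subst (1 2) all_nat) auto
qed

text \<open>Twice the average of the first block.\<close>
fun level :: "nat list \<Rightarrow> nat" where
  "level [] = 0"
| "level [x] = 2 * x"
| "level (x # y # r) = x + max x y"

lemma level_le_sum_list: "level xs \<le> 2 * sum_list xs"
  by (cases xs rule: level.cases) auto

text \<open>The bound on the last entry travels to the front: if the second entry is below 2, then
  the third is at least 2, and the first dominates the third.\<close>

lemma valid02_ge_2:
  assumes "valid02 xs" "xs \<noteq> []"
  shows "2 \<le> hd xs \<or> tl xs \<noteq> [] \<and> 2 \<le> hd (tl xs)"
  using assms
proof (induction xs rule: induct_list012)
  case (3 x y r)
  then show ?case by (cases r) auto
qed auto

lemma valid02_level_ge_2:
  assumes "valid02 xs" "xs \<noteq> []"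
  shows "2 \<le> level xs"
  using valid02_ge_2[OF assms] assms(2) by (cases xs rule: level.cases) auto

text \<open>Block averages decrease weakly, so bounding the first block bounds all blocks.\<close>

definition below_level :: "nat \<Rightarrow> nat list set" where
  "below_level s = {xs. valid02 xs \<and> level xs < s}"

text \<open>These are the tails allowed after a block \<open>b\<close>: at the same level, only a
  copy of \<open>b\<close> may follow.\<close>

definition below_or_block :: "nat list \<Rightarrow> nat list set" where
  "below_or_block b =
    {xs. valid02 xs \<and> (level xs < level b \<or> level xs = level b \<and> take (length b) xs = b)}"

text \<open>The condition on the level of \<open>k # r\<close> says that no larger entry follows
  \<open>k\<close>. For \<open>r = y # z # u\<close> a level of at most \<open>2 * k\<close> gives
  \<open>z <= k\<close>, except possibly at equality: \<open>z > k\<close> would force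
  \<open>y >= k - 1\<close> and level at least \<open>2 * k\<close>. At equality the prefix
  \<open>[k]\<close> settles it.\<close>

lemma valid02_single_append_iff:
  assumes "2 \<le> k"
  shows "valid02 (k # r) \<and> level (k # r) = 2 * k \<longleftrightarrow> r \<in> below_or_block [k]"
proof (cases r rule: level.cases)
  case (3 y z u)
  have "z \<le> y + 2" if "valid02 r"
    using that by (cases u) (auto simp: 3)
  with 3 assms show ?thesis
    by (auto simp: below_or_block_def max_def)
qed (use assms in \<open>auto simp: below_or_block_def max_def\<close>)

text \<open>For \<open>r = z # w # u\<close>, \<open>z > x\<close> gives level at least
  \<open>2 * x + 2 >= x + y\<close>, and \<open>w > y\<close> gives \<open>z >= y - 1\<close> and
  level at least \<open>2 * y > x + y\<close>. Among tails with \<open>z <= x\<close> and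
  \<open>w <= y\<close>, level \<open>x + y\<close> is reached only by the prefix
  \<open>[x, y]\<close>.\<close>

lemma valid02_pair_append_iff:
  assumes "x < y" "y \<le> x + 2" "2 \<le> y"
  shows "valid02 (x # y # r) \<longleftrightarrow> r \<in> below_or_block [x, y]"
proof (cases r rule: level.cases)
  case (3 z w u)
  have "w \<le> z + 2" if "valid02 r"
    using that by (cases u) (auto simp: 3)
  with 3 assms show ?thesis
    by (auto simp: below_or_block_def max_def)
qed (use assms in \<open>auto simp: below_or_block_def max_def\<close>)

text \<open>A geometric series in functional form: a list in the set either has smaller level or is
  \<open>b\<close> followed by another member.\<close>

lemma list_gf_below_or_block:
  assumes "\<And>r. valid02 (b @ r) \<and> level (b @ r) = level b \<longleftrightarrow> r \<in> below_or_block b"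
  shows "list_gf (below_or_block b) * (1 - fps_z ^ length b * fps_q ^ sum_list b) =
    list_gf (below_level (level b))"
proof -
  let ?W = "below_or_block b" and ?B = "below_level (level b)"
  have "?W = ?B \<union> {xs. valid02 xs \<and> level xs = level b \<and> (\<exists>r. xs = b @ r)}"
    by (auto simp: below_or_block_def below_level_def) (metis append_take_drop_id)
  also have "{xs. valid02 xs \<and> level xs = level b \<and> (\<exists>r. xs = b @ r)} = (@) b ` ?W"
    using assms by auto
  finally have "?W = ?B \<union> (@) b ` ?W" .
  moreover have "?B \<inter> (@) b ` ?W = {}"
    by (auto simp: below_level_def simp flip: assms)
  ultimately have "list_gf ?W = list_gf ?B + fps_z ^ length b * fps_q ^ sum_list b * list_gf ?W"
    using list_gf_Un_Int[of ?B "(@) b ` ?W"] by (simp add: list_gf_empty list_gf_append)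
  then show ?thesis
    by (simp add: algebra_simps)
qed

lemma list_gf_single:
  assumes "2 \<le> k"
  shows "list_gf (below_or_block [k]) * (1 - fps_z * fps_q ^ k) = list_gf (below_level (2 * k))"
  using list_gf_below_or_block[of "[k]"] valid02_single_append_iff[OF assms] by simp

lemma list_gf_pair:
  assumes "x < y" "y \<le> x + 2" "2 \<le> y"
  shows "list_gf (below_or_block [x, y]) * (1 - fps_z ^ 2 * fps_q ^ (x + y)) =
    list_gf (below_level (x + y))"
  using list_gf_below_or_block[of "[x, y]"] valid02_pair_append_iff[OF assms] assms(1)
  by (simp add: max_def power2_eq_square)

section \<open>First blocks available at each level\<close>

lemma valid02_level_cases:
  assumes "valid02 xs" "xs \<noteq> []"
  obtains k r where "xs = k # r" "level xs = 2 * k"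
  | k r where "xs = k # Suc k # r" "level xs = 2 * k + 1"
  | k r where "xs = k # Suc (Suc k) # r" "level xs = 2 * k + 2"
proof (cases xs rule: level.cases)
  case (3 x y r)
  have "y \<le> x + 2"
    using assms(1) by (cases r) (auto simp: 3)
  then consider "y \<le> x" | "y = Suc x" | "y = Suc (Suc x)"
    by linarith
  then show ?thesis
    using that 3 by cases auto
qed (use assms that in auto)

text \<open>Only one block has the odd level \<open>2 * k + 1\<close>.\<close>

lemma below_level_odd: "below_level (2 * k + 2) = below_or_block [k, Suc k]"
proof -
  have "take 2 xs = [k, Suc k]" if "valid02 xs" "level xs = 2 * k + 1" for xs
  proof -
    have "xs \<noteq> []"
      using that(2) by auto
    from valid02_level_cases[OF that(1) this] show ?thesis
      using that(2) by cases ((simp; presburger)+)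
  qed
  then show ?thesis
    by (auto simp: below_level_def below_or_block_def less_Suc_eq numeral_2_eq_2)
qed

text \<open>Two blocks share the level \<open>2 * k + 2\<close>. They differ in their first entry,
  so the overlap contains only smaller levels; this prepares inclusion-exclusion.\<close>

lemma below_level_even:
  "below_level (2 * k + 3) = below_or_block [Suc k] \<union> below_or_block [k, Suc (Suc k)]"
  "below_or_block [Suc k] \<inter> below_or_block [k, Suc (Suc k)] = below_level (2 * k + 2)"
proof -
  have "take 1 xs = [Suc k] \<or> take 2 xs = [k, Suc (Suc k)]"
    if "valid02 xs" "level xs = 2 * k + 2" for xs
  proof -
    have "xs \<noteq> []"
      using that(2) by auto
    from valid02_level_cases[OF that(1) this] show ?thesis
      using that(2) by cases ((simp; presburger)+)
  qed
  then show "below_level (2 * k + 3) = below_or_block [Suc k] \<union> below_or_block [k, Suc (Suc k)]"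
    by (auto simp: below_level_def below_or_block_def less_Suc_eq numeral_2_eq_2 numeral_3_eq_3)
  have "take 1 xs = [Suc k] \<Longrightarrow> take 2 xs \<noteq> [k, Suc (Suc k)]" for xs
    by (cases xs) auto
  then show "below_or_block [Suc k] \<inter> below_or_block [k, Suc (Suc k)] = below_level (2 * k + 2)"
    by (auto simp: below_level_def below_or_block_def numeral_2_eq_2)
qed

lemma below_level_2: "below_level 2 = {[]}"
  using valid02_level_ge_2 by (fastforce simp: below_level_def)

text \<open>Level 2 is exceptional: a leading 1 would need a second entry at most 1, contradicting
  \<open>valid02_ge_2\<close>.\<close>

lemma below_level_3: "below_level 3 = below_or_block [0, 2]"
proof -
  have "below_or_block [Suc 0] \<subseteq> below_level 2"
  proof
    fix xs assume xs: "xs \<in> below_or_block [Suc 0]"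
    have False if "xs = Suc 0 # r" "level xs = 2" for r
      using that xs valid02_ge_2[of xs]
      by (cases r) (auto simp: below_or_block_def max_def split: if_splits)
    with xs show "xs \<in> below_level 2"
      by (cases xs) (auto simp: below_or_block_def below_level_def)
  qed
  then show ?thesis
    using below_level_even[of 0] by (auto simp: numeral_2_eq_2)
qed

section \<open>Recurrences in the level and the finite product formula\<close>

lemma list_gf_below_level_3: "list_gf (below_level 3) * (1 - fps_z ^ 2 * fps_q ^ 2) = 1"
  using list_gf_pair[of 0 2] unfolding add_0 below_level_2 below_level_3 list_gf_Nil by simp

lemma list_gf_below_level_odd:
  assumes "1 \<le> k"
  shows "list_gf (below_level (2 * k + 2)) * (1 - fps_z ^ 2 * fps_q ^ (2 * k + 1)) =
    list_gf (below_level (2 * k + 1))"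
  using list_gf_pair[of k "Suc k"] assms unfolding below_level_odd by (simp add: mult_2)

lemma list_gf_below_level_even:
  assumes "1 \<le> k"
  shows "list_gf (below_level (2 * k + 3)) *
      ((1 - fps_z * fps_q ^ (k + 1)) * (1 - fps_z ^ 2 * fps_q ^ (2 * k + 2))) =
    list_gf (below_level (2 * k + 2)) * (1 - fps_z ^ 3 * fps_q ^ (3 * k + 3))"
proof -
  define H G P Q where "H = list_gf (below_level (2 * k + 3))"
    and "G = list_gf (below_level (2 * k + 2))"
    and "P = list_gf (below_or_block [Suc k])" and "Q = list_gf (below_or_block [k, Suc (Suc k)])"
  define A B where "A = fps_z * fps_q ^ (k + 1)" and "B = fps_z ^ 2 * fps_q ^ (2 * k + 2)"
  have AB: "fps_z ^ 3 * fps_q ^ (3 * k + 3) = A * B"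
    by (simp add: A_def B_def power_add power_mult numeral_3_eq_3 numeral_2_eq_2 algebra_simps)
  have P: "P * (1 - A) = G"
    using list_gf_single[of "Suc k"] assms by (simp add: P_def A_def G_def)
  have Q: "Q * (1 - B) = G"
    using list_gf_pair[of k "Suc (Suc k)"] assms by (simp add: Q_def B_def G_def mult_2)
  have "H + G = P + Q"
    using list_gf_Un_Int[of "below_or_block [Suc k]" "below_or_block [k, Suc (Suc k)]"]
    unfolding below_level_even(2) below_level_even(1)[symmetric]
    by (simp add: G_def H_def P_def Q_def)
  then have H: "H = P + Q - G"
    by (simp add: algebra_simps)
  have "H * ((1 - A) * (1 - B)) =
      P * (1 - A) * (1 - B) + Q * (1 - B) * (1 - A) - G * ((1 - A) * (1 - B))"
    unfolding H by (simp add: algebra_simps)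
  also have "\<dots> = G * (1 - A * B)"
    unfolding P Q by (simp add: algebra_simps)
  finally show ?thesis
    unfolding AB by (simp add: A_def B_def G_def H_def)
qed

text \<open>Each induction step passes one odd and one even level. The factors account for single
  blocks 2 to \<open>k + 1\<close> and pair sums 2 to \<open>2 * k + 2\<close>, the sum 2 coming
  from the base case.\<close>

lemma list_gf_below_level:
  "list_gf (below_level (2 * k + 3)) *
      ((\<Prod>i<k. 1 - fps_z * fps_q ^ 2 * fps_q ^ i) *
       (\<Prod>i<2 * k + 1. 1 - fps_z ^ 2 * fps_q ^ 2 * fps_q ^ i)) =
    (\<Prod>i<k. 1 - fps_z ^ 3 * fps_q ^ 6 * (fps_q ^ 3) ^ i)"
proof (induction k)
  case 0
  show ?case
    using list_gf_below_level_3 by simp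
next
  case (Suc k)
  define G where "G s = list_gf (below_level s)" for s
  define D1 D2 N where "D1 = (\<Prod>i<k. 1 - fps_z * fps_q ^ 2 * fps_q ^ i)"
    and "D2 = (\<Prod>i<2 * k + 1. 1 - fps_z ^ 2 * fps_q ^ 2 * fps_q ^ i)"
    and "N = (\<Prod>i<k. 1 - fps_z ^ 3 * fps_q ^ 6 * (fps_q ^ 3) ^ i)"
  define a b c d where "a = 1 - fps_z * fps_q ^ (k + 2)"
    and "b = 1 - fps_z ^ 2 * fps_q ^ (2 * k + 3)"
    and "c = 1 - fps_z ^ 2 * fps_q ^ (2 * k + 4)"
    and "d = 1 - fps_z ^ 3 * fps_q ^ (3 * k + 6)"
  have D1: "(\<Prod>i<Suc k. 1 - fps_z * fps_q ^ 2 * fps_q ^ i) = D1 * a"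
    by (simp add: D1_def a_def mult.assoc flip: power_add)
  have D2: "(\<Prod>i<2 * Suc k + 1. 1 - fps_z ^ 2 * fps_q ^ 2 * fps_q ^ i) = D2 * b * c"
    by (simp add: D2_def b_def c_def mult.assoc numeral_3_eq_3 eval_nat_numeral flip: power_add)
  have N: "(\<Prod>i<Suc k. 1 - fps_z ^ 3 * fps_q ^ 6 * (fps_q ^ 3) ^ i) = N * d"
    by (simp add: N_def d_def mult.assoc add.commute flip: power_add power_mult)
  have b: "G (2 * k + 4) * b = G (2 * k + 3)"
    using list_gf_below_level_odd[of "Suc k"] by (simp add: G_def b_def eval_nat_numeral)
  have ac: "G (2 * k + 5) * (a * c) = G (2 * k + 4) * d"
    using list_gf_below_level_even[of "Suc k"]
    by (simp add: G_def a_def c_def d_def eval_nat_numeral)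
  have "G (2 * k + 5) * (D1 * a * (D2 * b * c)) = G (2 * k + 5) * (a * c) * (D1 * D2 * b)"
    by (simp add: ac_simps)
  also have "\<dots> = G (2 * k + 4) * b * (D1 * D2) * d"
    unfolding ac by (simp add: ac_simps)
  also have "\<dots> = N * d"
    using Suc.IH unfolding b by (simp add: G_def D1_def D2_def N_def)
  finally show ?case
    unfolding D1 D2 N by (simp add: G_def eval_nat_numeral)
qed

section \<open>Passage to unbounded level\<close>

lemma list_gf_below_level_LIMSEQ: "(\<lambda>k. list_gf (below_level (2 * k + 3))) \<longlonglongrightarrow> zq_gf J02"
proof (rule tendsto_fpsI)
  fix n
  show "\<forall>\<^sub>F k in sequentially. fps_nth (list_gf (below_level (2 * k + 3))) n = fps_nth (zq_gf J02) n"
    using eventually_ge_at_top[of n]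
  proof eventually_elim
    case (elim k)
    have "{xs \<in> below_level (2 * k + 3). sum_list xs = n \<and> length xs = m} =
        {xs. is_02_partition n xs \<and> length xs = m}" for m
    proof -
      \<comment> \<open>The level is at most \<open>2 * n\<close>, so for \<open>k >= n\<close> the
        level bound excludes nothing of sum \<open>n\<close>.\<close>
      have "level xs < 2 * k + 3" if "sum_list xs = n" for xs
        using level_le_sum_list[of xs] elim that by linarith
      then show ?thesis
        by (auto simp: below_level_def valid02_def is_02_partition_def)
    qed
    then show ?case
      by (intro fps_ext) (simp add: list_gf_nth zq_gf_def J02_def)
  qed
qed

theorem theorem21:
  shows "zq_gf J02 =
    qpoch_inf (fps_z ^ 3 * fps_q ^ 6) (fps_q ^ 3) /
      (qpoch_inf (fps_z * fps_q ^ 2) fps_q * qpoch_inf (fps_z ^ 2 * fps_q ^ 2) fps_q)"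
proof (rule zq_fps_divide_eqI)
  let ?N = "qpoch_inf (fps_z ^ 3 * fps_q ^ 6) (fps_q ^ 3)"
    and ?D1 = "qpoch_inf (fps_z * fps_q ^ 2) fps_q"
    and ?D2 = "qpoch_inf (fps_z ^ 2 * fps_q ^ 2) fps_q"
  \<comment> \<open>The pair product has \<open>2 * k + 1\<close> factors, so its limit is taken
    along this subsequence.\<close>
  have "strict_mono (\<lambda>k::nat. 2 * k + 1)"
    by (simp add: strict_mono_def)
  note sub = LIMSEQ_subseq_LIMSEQ[OF _ this, unfolded comp_def]
  have "(\<lambda>k. \<Prod>i<k. 1 - fps_z * fps_q ^ 2 * fps_q ^ i) \<longlonglongrightarrow> ?D1"
    by (intro qpoch_inf_LIMSEQ) simp_all
  moreover have "(\<lambda>k. \<Prod>i<2 * k + 1. 1 - fps_z ^ 2 * fps_q ^ 2 * fps_q ^ i) \<longlonglongrightarrow> ?D2"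
    by (intro sub qpoch_inf_LIMSEQ) simp_all
  ultimately have "(\<lambda>k. list_gf (below_level (2 * k + 3)) *
      ((\<Prod>i<k. 1 - fps_z * fps_q ^ 2 * fps_q ^ i) *
       (\<Prod>i<2 * k + 1. 1 - fps_z ^ 2 * fps_q ^ 2 * fps_q ^ i))) \<longlonglongrightarrow> zq_gf J02 * (?D1 * ?D2)"
    by (intro tendsto_mult_fps list_gf_below_level_LIMSEQ)
  moreover have "(\<lambda>k. \<Prod>i<k. 1 - fps_z ^ 3 * fps_q ^ 6 * (fps_q ^ 3) ^ i) \<longlonglongrightarrow> ?N"
    by (intro qpoch_inf_LIMSEQ) simp_all
  ultimately show "zq_gf J02 * (?D1 * ?D2) = ?N"
    unfolding list_gf_below_level by (rule LIMSEQ_unique)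
  show "fps_nth (?D1 * ?D2) 0 = 1"
    by (simp add: qpoch_inf_nth_0)
qed

end
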